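(* For all positive integers $n,k,\ell$ with $k\ge \ell$, \[ \frac{n^k}{\ell(n-1)+1}\le a_{n,k,\ell}\le n^{k-1}. \]
   Context: Let $H_{n,k}=\{0,1,\dots,n-1\}^k$ (the $k$-dimensional hypercube of side length $n$). For $\ell\le k$, an $\ell$-rook is a point $P\in H_{n,k}$ together with a set $D$ of $\ell$ of the $k$ coordinate indices; it covers (attacks) the point $P$ itself and every point of $H_{n,k}$ which differs from $P$ in exactly one coordinate, that coordinate belonging to $D$. Distinct rooks must occupy distinct points. $a_{n,k,\ell}$ is the minimum number of $\ell$-rooks whose covered sets together cover all of $H_{n,k}$. *)

theory Defs
  imports Complex_Main "HOL-Library.FuncSet"
begin

text \<open>Coordinates are indexed by \<open>0, \<dots>, k - 1\<close>. Points are extensional functions (constantly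
  \<open>undefined\<close> off the index set), so equality of points is equality of all \<open>k\<close> coordinates.\<close>

definition hypercube :: "nat \<Rightarrow> nat \<Rightarrow> (nat \<Rightarrow> nat) set" where
  "hypercube n k = {..<k} \<rightarrow>\<^sub>E {..<n}"

type_synonym rook = "(nat \<Rightarrow> nat) \<times> nat set"

definition rooks :: "nat \<Rightarrow> nat \<Rightarrow> nat \<Rightarrow> rook set" where
  "rooks n k l = {(P, D). P \<in> hypercube n k \<and> D \<subseteq> {..<k} \<and> card D = l}"

text \<open>The set of coordinates where \<open>P\<close> and \<open>Q\<close> differ being a singleton \<open>{i}\<close> says that they
  differ in exactly one coordinate, namely \<open>i\<close>.\<close>

definition covered :: "nat \<Rightarrow> nat \<Rightarrow> rook \<Rightarrow> (nat \<Rightarrow> nat) set" where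
  "covered n k = (\<lambda>(P, D).
     {Q \<in> hypercube n k. Q = P \<or> (\<exists>i\<in>D. {j \<in> {..<k}. Q j \<noteq> P j} = {i})})"

text \<open>Injectivity of \<open>fst\<close> says that distinct rooks occupy distinct points.\<close>

definition covering_placement :: "nat \<Rightarrow> nat \<Rightarrow> nat \<Rightarrow> rook set \<Rightarrow> bool" where
  "covering_placement n k l R \<longleftrightarrow>
     R \<subseteq> rooks n k l \<and> inj_on fst R \<and> (\<Union>r\<in>R. covered n k r) = hypercube n k"

definition rook_cover_number :: "nat \<Rightarrow> nat \<Rightarrow> nat \<Rightarrow> nat" where
  "rook_cover_number n k l = (LEAST m. \<exists>R. covering_placement n k l R \<and> card R = m)"

text \<open>The two facts below show that \<open>card\<close> and \<open>LEAST\<close> are meaningful here: placements are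
  finite, and for \<open>l \<le> k\<close> the minimum is over a nonempty set and hence attained.\<close>

lemma covering_placement_finite:
  assumes "covering_placement n k l R"
  shows "finite R"
proof -
  have "R \<subseteq> hypercube n k \<times> Pow {..<k}"
    using assms by (auto simp: covering_placement_def rooks_def)
  moreover have "finite (hypercube n k)"
    by (simp add: hypercube_def finite_PiE)
  ultimately show ?thesis
    by (meson finite_Pow_iff finite_SigmaI finite_lessThan finite_subset)
qed

lemma rook_cover_number_attained:
  assumes "l \<le> k"
  shows "\<exists>R. covering_placement n k l R \<and> card R = rook_cover_number n k l"
proof -
  have "covering_placement n k l ((\<lambda>P. (P, {..<l})) ` hypercube n k)"
    using assms by (auto simp: covering_placement_def rooks_def covered_def inj_on_def)
  then have "\<exists>m R. covering_placement n k l R \<and> card R = m"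
    by blast
  then show ?thesis
    unfolding rook_cover_number_def by (rule LeastI_ex)
qed

end

theory Submission
  imports Defs
begin

text \<open>A single \<open>\<ell>\<close>-rook covers at most \<open>\<ell>(n - 1) + 1\<close> points, which gives the lower bound.
  For the upper bound, place rooks on the face \<open>P 0 = 0\<close>, each attacking along coordinate \<open>0\<close>.\<close>

lemma card_hypercube: "card (hypercube n k) = n ^ k"
  by (simp add: hypercube_def card_PiE)

text \<open>An attacked point other than \<open>P\<close> arises from \<open>P\<close> by
  overwriting one coordinate with a different value, so it lies on a punctured line through
  \<open>P\<close>; this form is ready for a union bound. Indices of \<open>D\<close> beyond
  \<open>k\<close> attack nothing, as the set of differing coordinates lies in
  \<open>{..<k}\<close>; hence the intersection.\<close>

lemma covered_subset:
  assumes "P \<in> hypercube n k"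
  shows "covered n k (P, D) \<subseteq>
    insert P (\<Union>i\<in>D \<inter> {..<k}. (\<lambda>v. P(i := v)) ` ({..<n} - {P i}))"
proof
  fix Q assume "Q \<in> covered n k (P, D)"
  then have Q: "Q \<in> hypercube n k"
    and QP: "Q = P \<or> (\<exists>i\<in>D. {j \<in> {..<k}. Q j \<noteq> P j} = {i})"
    unfolding covered_def by simp_all
  from QP show "Q \<in> insert P (\<Union>i\<in>D \<inter> {..<k}. (\<lambda>v. P(i := v)) ` ({..<n} - {P i}))"
  proof (elim disjE bexE)
    fix i assume "i \<in> D" and diff: "{j \<in> {..<k}. Q j \<noteq> P j} = {i}"
    have i: "i < k" "Q i \<noteq> P i"
      using diff by auto
    have same: "Q j = P j" if "j < k" "j \<noteq> i" for j
      using diff that by auto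
    have "Q = P(i := Q i)"
    proof
      fix j
      show "Q j = (P(i := Q i)) j"
      proof (cases "j < k")
        case True
        then show ?thesis
          using same by simp
      next
        \<comment> \<open>Off the index set both points are \<open>undefined\<close>, and the update
          at \<open>i < k\<close> does not reach \<open>j\<close>.\<close>
        case False
        then show ?thesis
          using PiE_arb[of Q _ _ j] PiE_arb[of P _ _ j] Q assms i by (auto simp: hypercube_def)
      qed
    qed
    moreover have "Q i \<in> {..<n} - {P i}"
      using Q i by (auto simp: hypercube_def)
    ultimately have "Q \<in> (\<lambda>v. P(i := v)) ` ({..<n} - {P i})"
      by (rule image_eqI)
    then show ?thesis
      using \<open>i \<in> D\<close> i by (intro insertI2 UN_I[of i]) simp_all
  qed simp
qed

text \<open>Each of the \<open>l\<close> lines through \<open>P\<close> contributes at most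
  \<open>n - 1\<close> points besides \<open>P\<close>, and \<open>P\<close> itself adds
  one.\<close>

lemma card_covered_le:
  assumes "r \<in> rooks n k l"
  shows "card (covered n k r) \<le> l * (n - 1) + 1"
proof -
  obtain P D where r: "r = (P, D)" and P: "P \<in> hypercube n k"
    and D: "D \<subseteq> {..<k}" and l: "card D = l"
    using assms by (auto simp: rooks_def)
  have fin: "finite D"
    using D finite_subset by blast
  let ?L = "\<lambda>i. (\<lambda>v. P(i := v)) ` ({..<n} - {P i})"
  have "card (?L i) \<le> n - 1" if "i \<in> D" for i
  proof -
    \<comment> \<open>This makes \<open>P i\<close> a genuine element of \<open>{..<n}\<close>, so
      removing it really lowers the cardinality to \<open>n - 1\<close>.\<close>
    have "P i < n"
      using P D that by (auto simp: hypercube_def)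
    then have "card ({..<n} - {P i}) = n - 1"
      by simp
    then show ?thesis
      using card_image_le[of "{..<n} - {P i}" "\<lambda>v. P(i := v)"] by simp
  qed
  then have "(\<Sum>i\<in>D. card (?L i)) \<le> l * (n - 1)"
    using sum_bounded_above[of D "\<lambda>i. card (?L i)" "n - 1"] l by simp
  with card_UN_le[OF fin, of ?L] have "card (\<Union>i\<in>D. ?L i) \<le> l * (n - 1)"
    by linarith
  moreover have "covered n k r \<subseteq> insert P (\<Union>i\<in>D. ?L i)"
    using covered_subset[OF P, of D] D by (simp add: r Int_absorb2)
  then have "card (covered n k r) \<le> card (insert P (\<Union>i\<in>D. ?L i))"
    using fin by (intro card_mono) auto
  moreover have "card (insert P (\<Union>i\<in>D. ?L i)) \<le> Suc (card (\<Union>i\<in>D. ?L i))"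
    using fin by (simp add: card_insert_if)
  ultimately show ?thesis
    by linarith
qed

text \<open>Union bound over the rooks, kept in multiplied form so that the counting stays in the
  naturals.\<close>

lemma card_covering_placement_ge:
  assumes "covering_placement n k l R"
  shows "n ^ k \<le> card R * (l * (n - 1) + 1)"
proof -
  have "n ^ k = card (\<Union>r\<in>R. covered n k r)"
    using assms by (simp add: covering_placement_def card_hypercube)
  also have "\<dots> \<le> (\<Sum>r\<in>R. card (covered n k r))"
    by (rule card_UN_le[OF covering_placement_finite[OF assms]])
  also have "\<dots> \<le> card R * (l * (n - 1) + 1)"
  proof -
    have "card (covered n k r) \<le> l * (n - 1) + 1" if "r \<in> R" for r
      using assms that by (intro card_covered_le) (auto simp: covering_placement_def)
    then show ?thesis
      using sum_bounded_above[of R "\<lambda>r. card (covered n k r)" "l * (n - 1) + 1"] by simp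
  qed
  finally show ?thesis .
qed

lemma rook_cover_number_le:
  assumes "covering_placement n k l R"
  shows "rook_cover_number n k l \<le> card R"
  unfolding rook_cover_number_def using assms by (blast intro: Least_le)

text \<open>Each \<open>Q\<close> is covered by the rook at its projection \<open>Q(0 := 0)\<close>
  onto the face: either \<open>Q\<close> is that position, or the two differ in coordinate 0 alone,
  which belongs to \<open>{..<l}\<close> because \<open>l\<close> is positive.\<close>

lemma covering_placement_face:
  assumes "n \<ge> 1" and "l \<ge> 1" and "k \<ge> l"
  shows "covering_placement n k l ((\<lambda>P. (P, {..<l})) ` {P \<in> hypercube n k. P 0 = 0})"
proof -
  have "\<exists>P \<in> hypercube n k. P 0 = 0 \<and> Q \<in> covered n k (P, {..<l})"
    if Q: "Q \<in> hypercube n k" for Q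
  proof (intro bexI conjI)
    show "Q(0 := 0) \<in> hypercube n k"
      using Q assms by (auto simp: hypercube_def PiE_iff extensional_def)
    show "Q \<in> covered n k (Q(0 := 0), {..<l})"
    proof (cases "Q 0 = 0")
      case True
      then show ?thesis
        using Q by (simp add: covered_def fun_upd_idem)
    next
      case False
      then have "{j \<in> {..<k}. Q j \<noteq> (Q(0 := 0)) j} = {0}"
        using assms by auto
      then show ?thesis
        using Q assms by (auto simp: covered_def)
    qed
  qed simp
  moreover have "covered n k r \<subseteq> hypercube n k" for r
    by (auto simp: covered_def split: prod.split)
  ultimately have "(\<Union>P\<in>{P \<in> hypercube n k. P 0 = 0}. covered n k (P, {..<l})) = hypercube n k"
    by blast
  then show ?thesis
    using assms unfolding covering_placement_def
    by (auto simp: rooks_def inj_on_def)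
qed

text \<open>The face is itself an extensional product, with factor \<open>{0}\<close> at index 0, so
  \<open>card_PiE\<close> applies.\<close>

lemma card_hypercube_face:
  assumes "n \<ge> 1" and "k \<ge> 1"
  shows "card {P \<in> hypercube n k. P 0 = 0} = n ^ (k - 1)"
proof -
  have "{P \<in> hypercube n k. P 0 = 0} = (\<Pi>\<^sub>E i\<in>{..<k}. if i = 0 then {0} else {..<n})"
  proof (rule set_eqI)
    fix P :: "nat \<Rightarrow> nat"
    have "(\<forall>i<k. P i < n) \<and> P 0 = 0 \<longleftrightarrow> (\<forall>i<k. P i \<in> (if i = 0 then {0} else {..<n}))"
      using assms by (metis One_nat_def Suc_le_eq lessThan_iff singleton_iff)
    then show "P \<in> {P \<in> hypercube n k. P 0 = 0} \<longleftrightarrow>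
        P \<in> (\<Pi>\<^sub>E i\<in>{..<k}. if i = 0 then {0} else {..<n})"
      unfolding hypercube_def PiE_iff mem_Collect_eq lessThan_iff Ball_def by blast
  qed
  then have "card {P \<in> hypercube n k. P 0 = 0} =
      (\<Prod>i<k. card (if i = 0 then {0} else {..<n}))"
    by (simp add: card_PiE)
  \<comment> \<open>Writing \<open>k\<close> as a successor lets the factor 1 at index 0 be split
    off, leaving \<open>k - 1\<close> factors \<open>n\<close>.\<close>
  also have "\<dots> = (\<Prod>i<Suc (k - 1). if i = 0 then 1 else n)"
    using assms by (intro prod.cong) auto
  also have "\<dots> = n ^ (k - 1)"
    by (subst prod.lessThan_Suc_shift) simp
  finally show ?thesis .
qed

theorem theorem2:
  fixes n k l :: nat
  assumes "n \<ge> 1" and "k \<ge> 1" and "l \<ge> 1" and "k \<ge> l"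
  shows "real n ^ k / (real l * (real n - 1) + 1) \<le> real (rook_cover_number n k l)
       \<and> rook_cover_number n k l \<le> n ^ (k - 1)"
proof
  obtain R where "covering_placement n k l R" "card R = rook_cover_number n k l"
    using rook_cover_number_attained[OF assms(4)] by blast
  then have "n ^ k \<le> rook_cover_number n k l * (l * (n - 1) + 1)"
    using card_covering_placement_ge by metis
  then have "real (n ^ k) \<le> real (rook_cover_number n k l * (l * (n - 1) + 1))"
    by (rule of_nat_mono)
  \<comment> \<open>Since \<open>n\<close> is positive, truncated subtraction agrees with real
    subtraction.\<close>
  moreover have "real (l * (n - 1) + 1) = real l * (real n - 1) + 1"
    using assms(1) by simp
  ultimately have "real n ^ k \<le> real (rook_cover_number n k l) * (real l * (real n - 1) + 1)"
    by (simp only: of_nat_mult of_nat_power)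
  moreover have "0 < real l * (real n - 1) + 1"
    using assms(1) by (simp add: add_nonneg_pos)
  ultimately show "real n ^ k / (real l * (real n - 1) + 1) \<le> real (rook_cover_number n k l)"
    by (simp add: pos_divide_le_eq)
next
  let ?F = "{P \<in> hypercube n k. P 0 = 0}"
  have "rook_cover_number n k l \<le> card ((\<lambda>P. (P, {..<l})) ` ?F)"
    by (rule rook_cover_number_le[OF covering_placement_face[OF assms(1,3,4)]])
  \<comment> \<open>All rooks share one direction set, so rooks correspond bijectively to their
    positions.\<close>
  also have "\<dots> = card ?F"
    by (rule card_image) (simp add: inj_on_def)
  also have "\<dots> = n ^ (k - 1)"
    by (rule card_hypercube_face[OF assms(1,2)])
  finally show "rook_cover_number n k l \<le> n ^ (k - 1)" .
qed

end
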